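(* Let $\bar{x}$ be a feasible point of (NSOCP). Nondegeneracy holds at $\bar{x}$ if, and only if, weak-nondegeneracy holds at $\bar{x}$ and, in addition, the matrix $M$ obtained by stacking vertically the blocks $D\widehat{g}_j(\bar{x})$, $j\in I_0(\bar{x})$, that is, $$M=\begin{bmatrix}\vdots\\ D\widehat{g}_{j}(\bar{x})\\ \vdots\end{bmatrix}_{j\in I_0(\bar{x})},$$ is surjective (as a linear map from $\mathbb{R}^n$ to $\prod_{j\in I_0(\bar{x})}\mathbb{R}^{m_j-1}$).
   Context: Norms are Euclidean. For $m\ge 2$ write $y=(y_0,\widehat{y})\in\mathbb{R}\times\mathbb{R}^{m-1}$, and let $\mathbb{L}_m=\{y\in\mathbb{R}^m: y_0\ge\|\widehat{y}\|\}$ be the second-order cone. Let $\mathrm{bd}_+\mathbb{L}_m$ be its boundary minus the origin. Problem (NSOCP): minimize $f(x)$ over $x\in\mathbb{R}^n$ subject to $g_j(x)\in\mathbb{L}_{m_j}$, $j=1,\dots,q$, where $f:\mathbb{R}^n\to\mathbb{R}$ and $g_j=(g_{j,0},\widehat{g}_j):\mathbb{R}^n\to\mathbb{R}^{m_j}$ are continuously differentiable and $m_j\ge 2$ for all $j$. $D$ denotes the Jacobian matrix. For feasible $x$: $I_0(x)=\{j: g_j(x)=0\}$, $I_B(x)=\{j: g_j(x)\in\mathrm{bd}_+\mathbb{L}_{m_j}\}$. Eigenvectors: for $y\in\mathbb{R}^m$, $u_1(y)=\frac12(1,-w)$ and $u_2(y)=\frac12(1,w)$, where $w=\widehat{y}/\|\widehat{y}\|$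 if $\widehat{y}\ne0$, and $w\in\mathbb{R}^{m-1}$ is any unit vector (free choice, the same $w$ for $u_1$ and $u_2$) if $\widehat{y}=0$. Let $\Gamma_j=\begin{bmatrix}1&0\\0&-\mathbb{I}_{m_j-1}\end{bmatrix}$, where $\mathbb{I}_{m_j-1}$ is the identity matrix. Nondegeneracy holds at $\bar{x}$ if the only solution of $$\sum_{j\in I_B(\bar{x})}a_j\,Dg_j(\bar{x})^\top\Gamma_j g_j(\bar{x})+\sum_{j\in I_0(\bar{x})}Dg_j(\bar{x})^\top v_j=0,\qquad a_j\in\mathbb{R},\ v_j\in\mathbb{R}^{m_j},$$ is $a_j=0$, $v_j=0$ for all $j$. Weak-nondegeneracy holds at $\bar{x}$ if, for each sequence $x^k\to\bar{x}$ in $\mathbb{R}^n$, there exist an infinite set $I\subseteq\mathbb{N}$ and (a choice of) eigenvector sequences converging along $k\in I$, $u_1(g_j(x^k))\to\frac12(1,-\bar{w}_j)$ and $u_2(g_j(x^k))\to\frac12(1,\bar{w}_j)$ with $\|\bar{w}_j\|=1$, for every $j\in I_0(\bar{x})$, such that the family $$\left\{Dg_{j}(\bar{x})^\top u_1(g_{j}(\bar{x}))\right\}_{j\in I_B(\bar{x})}\cup\left\{ Dg_{j}(\bar{x})^\top (1,-\bar{w}_{j}),\ Dg_{j}(\bar{x})^\top (1,\bar{w}_{j}) \right\}_{j\in I_0(\bar{x})}$$ is linearly independent. *)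

theory Defs
  imports "HOL-Analysis.Analysis"
begin

section \<open>Vectors of varying dimension\<close>

text \<open>
  The dimensions \<open>m j\<close> of the constraint blocks vary with \<open>j\<close>, so \<open>\<real>\<^sup>m\<close> is rendered by the library
  space \<^const>\<open>Euclidean_space\<close>: functions \<open>nat \<Rightarrow> real\<close> vanishing from index \<open>m\<close> on, with
  the (Euclidean) topology inherited from the product. The decision space \<open>\<real>\<^sup>n\<close> is \<open>real ^ 'n\<close>.
\<close>

abbreviation Rsp :: "nat \<Rightarrow> (nat \<Rightarrow> real) set" where
  "Rsp m \<equiv> topspace (Euclidean_space m)"

abbreviation zvec :: "nat \<Rightarrow> real" where
  "zvec \<equiv> (\<lambda>_. 0)"

definition enorm :: "nat \<Rightarrow> (nat \<Rightarrow> real) \<Rightarrow> real" where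
  "enorm m y = L2_set y {..<m}"

text \<open>\<open>y = (y 0, hat y)\<close> with \<open>hat y \<in> \<real>\<^sup>m\<^sup>-\<^sup>1\<close> reindexed from 0; conversely \<open>(a, w)\<close> is \<open>case_nat a w\<close>.\<close>

definition hat :: "(nat \<Rightarrow> real) \<Rightarrow> nat \<Rightarrow> real" where
  "hat y = (\<lambda>i. y (Suc i))"

section \<open>The second-order cone\<close>

definition soc :: "nat \<Rightarrow> (nat \<Rightarrow> real) set" where
  "soc m = {y \<in> Rsp m. y 0 \<ge> enorm (m - 1) (hat y)}"

definition bd_plus :: "nat \<Rightarrow> (nat \<Rightarrow> real) set" where
  "bd_plus m = Euclidean_space m frontier_of soc m - {zvec}"

section \<open>Jacobians\<close>

definition grad :: "(real ^ 'n \<Rightarrow> real) \<Rightarrow> real ^ 'n \<Rightarrow> real ^ 'n" where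
  "grad h x = (\<chi> l. frechet_derivative h (at x) (axis l 1))"

definition cont_diff :: "(real ^ 'n \<Rightarrow> real) \<Rightarrow> bool" where
  "cont_diff h \<longleftrightarrow> (\<forall>x. h differentiable (at x)) \<and> continuous_on UNIV (grad h)"

definition cont_diff_map :: "nat \<Rightarrow> (real ^ 'n \<Rightarrow> nat \<Rightarrow> real) \<Rightarrow> bool" where
  "cont_diff_map m G \<longleftrightarrow> range G \<subseteq> Rsp m \<and> (\<forall>i<m. cont_diff (\<lambda>x. G x i))"

text \<open>The Jacobian is the family of its rows. For \<open>G\<close> into \<open>\<real>\<^sup>m\<close> the rows with index \<open>\<ge> m\<close>
  vanish, being gradients of the zero function, so \<open>mat_app (jac G x) d\<close> lies in \<open>\<real>\<^sup>m\<close>.\<close>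

definition jac :: "(real ^ 'n \<Rightarrow> nat \<Rightarrow> real) \<Rightarrow> real ^ 'n \<Rightarrow> nat \<Rightarrow> real ^ 'n" where
  "jac G x = (\<lambda>i. grad (\<lambda>z. G z i) x)"

definition mat_app :: "(nat \<Rightarrow> real ^ 'n) \<Rightarrow> real ^ 'n \<Rightarrow> nat \<Rightarrow> real" where
  "mat_app J d = (\<lambda>i. J i \<bullet> d)"

definition transp_app :: "nat \<Rightarrow> (nat \<Rightarrow> real ^ 'n) \<Rightarrow> (nat \<Rightarrow> real) \<Rightarrow> real ^ 'n" where
  "transp_app m J v = (\<Sum>i<m. v i *\<^sub>R J i)"

definition Gamma_mat :: "nat \<Rightarrow> nat \<Rightarrow> real" where
  "Gamma_mat i k = (if i \<noteq> k then 0 else if i = 0 then 1 else - 1)"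

definition Gamma_app :: "nat \<Rightarrow> (nat \<Rightarrow> real) \<Rightarrow> nat \<Rightarrow> real" where
  "Gamma_app m y = (\<lambda>i. \<Sum>k<m. Gamma_mat i k * y k)"

section \<open>Eigenvectors\<close>

definition hat_dir :: "nat \<Rightarrow> (nat \<Rightarrow> real) \<Rightarrow> nat \<Rightarrow> real" where
  "hat_dir m y = (\<lambda>i. hat y i / enorm (m - 1) (hat y))"

text \<open>All admissible choices of the unit vector \<open>w\<close> at \<open>y \<in> \<real>\<^sup>m\<close>; a choice of eigenvectors of \<open>y\<close>
  is the pair \<open>eig1 w\<close>, \<open>eig2 w\<close> for one \<open>w \<in> dirs m y\<close>.\<close>

definition dirs :: "nat \<Rightarrow> (nat \<Rightarrow> real) \<Rightarrow> (nat \<Rightarrow> real) set" where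
  "dirs m y = {w \<in> Rsp (m - 1).
     if hat y \<noteq> zvec then w = hat_dir m y else enorm (m - 1) w = 1}"

definition eig1 :: "(nat \<Rightarrow> real) \<Rightarrow> nat \<Rightarrow> real" where
  "eig1 w = (\<lambda>i. 1/2 * case_nat 1 (\<lambda>k. - w k) i)"

definition eig2 :: "(nat \<Rightarrow> real) \<Rightarrow> nat \<Rightarrow> real" where
  "eig2 w = (\<lambda>i. 1/2 * case_nat 1 w i)"

section \<open>The problem and its constraint qualifications\<close>

text \<open>The constraint map is \<open>g j :: real ^ 'n \<Rightarrow> nat \<Rightarrow> real\<close> with values in \<open>\<real>\<^sup>m\<close>, \<open>m = m j\<close>, for
  \<open>j \<in> {1..q}\<close>.\<close>

definition nsocp :: "nat \<Rightarrow> (nat \<Rightarrow> nat) \<Rightarrow> (real ^ 'n \<Rightarrow> real) \<Rightarrow>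
    (nat \<Rightarrow> real ^ 'n \<Rightarrow> nat \<Rightarrow> real) \<Rightarrow> bool" where
  "nsocp q m f g \<longleftrightarrow> cont_diff f \<and> (\<forall>j\<in>{1..q}. 2 \<le> m j \<and> cont_diff_map (m j) (g j))"

definition feasible :: "nat \<Rightarrow> (nat \<Rightarrow> nat) \<Rightarrow> (nat \<Rightarrow> real ^ 'n \<Rightarrow> nat \<Rightarrow> real) \<Rightarrow>
    real ^ 'n \<Rightarrow> bool" where
  "feasible q m g x \<longleftrightarrow> (\<forall>j\<in>{1..q}. g j x \<in> soc (m j))"

definition I0 :: "nat \<Rightarrow> (nat \<Rightarrow> real ^ 'n \<Rightarrow> nat \<Rightarrow> real) \<Rightarrow> real ^ 'n \<Rightarrow> nat set" where
  "I0 q g x = {j \<in> {1..q}. g j x = zvec}"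

definition IB :: "nat \<Rightarrow> (nat \<Rightarrow> nat) \<Rightarrow> (nat \<Rightarrow> real ^ 'n \<Rightarrow> nat \<Rightarrow> real) \<Rightarrow>
    real ^ 'n \<Rightarrow> nat set" where
  "IB q m g x = {j \<in> {1..q}. g j x \<in> bd_plus (m j)}"

definition nondegenerate :: "nat \<Rightarrow> (nat \<Rightarrow> nat) \<Rightarrow> (nat \<Rightarrow> real ^ 'n \<Rightarrow> nat \<Rightarrow> real) \<Rightarrow>
    real ^ 'n \<Rightarrow> bool" where
  "nondegenerate q m g x \<longleftrightarrow>
     (\<forall>(a :: nat \<Rightarrow> real) (v :: nat \<Rightarrow> nat \<Rightarrow> real).
        (\<forall>j\<in>I0 q g x. v j \<in> Rsp (m j)) \<longrightarrow>
        (\<Sum>j\<in>IB q m g x. a j *\<^sub>R transp_app (m j) (jac (g j) x) (Gamma_app (m j) (g j x)))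
          + (\<Sum>j\<in>I0 q g x. transp_app (m j) (jac (g j) x) (v j)) = 0 \<longrightarrow>
        (\<forall>j\<in>IB q m g x. a j = 0) \<and> (\<forall>j\<in>I0 q g x. v j = zvec))"

text \<open>Linear independence of an indexed family, so a repeated vector makes it dependent.\<close>

definition lin_indep_family :: "('i \<Rightarrow> 'a::real_vector) \<Rightarrow> 'i set \<Rightarrow> bool" where
  "lin_indep_family F S \<longleftrightarrow> inj_on F S \<and> independent (F ` S)"

definition wnd_family :: "(nat \<Rightarrow> nat) \<Rightarrow> (nat \<Rightarrow> real ^ 'n \<Rightarrow> nat \<Rightarrow> real) \<Rightarrow>
    real ^ 'n \<Rightarrow> (nat \<Rightarrow> nat \<Rightarrow> real) \<Rightarrow> nat + (nat + nat) \<Rightarrow> real ^ 'n" where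
  "wnd_family m g x wbar =
     case_sum (\<lambda>j. transp_app (m j) (jac (g j) x) (eig1 (hat_dir (m j) (g j x))))
    (case_sum (\<lambda>j. transp_app (m j) (jac (g j) x) (case_nat 1 (\<lambda>k. - wbar j k)))
              (\<lambda>j. transp_app (m j) (jac (g j) x) (case_nat 1 (wbar j))))"

text \<open>Convergence along \<open>k \<in> I\<close> is convergence in the filter \<open>inf sequentially (principal I)\<close>.
  A single \<open>I\<close> serves all \<open>j\<close>, and \<open>w j k\<close> is the choice of unit vector at \<open>g j (X k)\<close>.\<close>

definition weak_nondegenerate :: "nat \<Rightarrow> (nat \<Rightarrow> nat) \<Rightarrow>
    (nat \<Rightarrow> real ^ 'n \<Rightarrow> nat \<Rightarrow> real) \<Rightarrow> real ^ 'n \<Rightarrow> bool" where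
  "weak_nondegenerate q m g x \<longleftrightarrow>
     (\<forall>X :: nat \<Rightarrow> real ^ 'n. X \<longlonglongrightarrow> x \<longrightarrow>
        (\<exists>(I :: nat set) (w :: nat \<Rightarrow> nat \<Rightarrow> nat \<Rightarrow> real) (wbar :: nat \<Rightarrow> nat \<Rightarrow> real).
           infinite I \<and>
           (\<forall>j\<in>I0 q g x.
              (\<forall>k\<in>I. w j k \<in> dirs (m j) (g j (X k))) \<and>
              wbar j \<in> Rsp (m j - 1) \<and> enorm (m j - 1) (wbar j) = 1 \<and>
              limitin (Euclidean_space (m j)) (\<lambda>k. eig1 (w j k)) (eig1 (wbar j))
                (inf sequentially (principal I)) \<and>
              limitin (Euclidean_space (m j)) (\<lambda>k. eig2 (w j k)) (eig2 (wbar j))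
                (inf sequentially (principal I))) \<and>
           lin_indep_family (wnd_family m g x wbar)
             (IB q m g x <+> (I0 q g x <+> I0 q g x))))"

text \<open>The linear map of the matrix obtained by stacking the Jacobians of \<open>hat \<circ> g j\<close>, \<open>j \<in> I0 q g x\<close>; its
  codomain, the product of the spaces \<open>\<real>\<^sup>m\<^sup>-\<^sup>1\<close>, \<open>m = m j\<close>, is the extensional \<open>stacked_codomain\<close>.\<close>

definition stacked_map :: "nat \<Rightarrow> (nat \<Rightarrow> real ^ 'n \<Rightarrow> nat \<Rightarrow> real) \<Rightarrow> real ^ 'n \<Rightarrow>
    real ^ 'n \<Rightarrow> nat \<Rightarrow> nat \<Rightarrow> real" where
  "stacked_map q g x d = (\<lambda>j\<in>I0 q g x. mat_app (jac (\<lambda>z. hat (g j z)) x) d)"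

definition stacked_codomain :: "nat \<Rightarrow> (nat \<Rightarrow> nat) \<Rightarrow> (nat \<Rightarrow> real ^ 'n \<Rightarrow> nat \<Rightarrow> real) \<Rightarrow>
    real ^ 'n \<Rightarrow> (nat \<Rightarrow> nat \<Rightarrow> real) set" where
  "stacked_codomain q m g x = (\<Pi>\<^sub>E j\<in>I0 q g x. Rsp (m j - 1))"

end

theory Submission
  imports Defs
begin

text \<open>
  Write \<open>J\<^sub>j\<close> for the Jacobian of \<open>g j\<close> at the given point, and \<open>J\<^sub>j 0\<close>, \<open>J\<^sub>j (Suc i)\<close> for its rows. On the
  boundary of the cone \<open>\<Gamma> y\<close> is a positive multiple of the eigenvector \<open>u\<^sub>1(y)\<close>, so nondegeneracy
  says that the vectors \<open>J\<^sub>j\<^sup>T u\<^sub>1\<close> for \<open>j\<close> in \<open>IB\<close>, together with \<^emph>\<open>all\<close> rows of \<open>J\<^sub>j\<close> for \<open>j\<close> in \<open>I0\<close>, are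
  linearly independent (\<open>nondegenerate_iff\<close>). The family of weak-nondegeneracy spans the same
  space as the vectors \<open>J\<^sub>j\<^sup>T u\<^sub>1\<close>, the leading rows \<open>J\<^sub>j 0\<close> and, for each \<open>j\<close> in \<open>I0\<close>, the single
  combination of hat rows with the coefficients \<open>wbar j\<close> (\<open>sum_wnd_family\<close>).

  Nondegeneracy therefore gives independence of the hat rows, hence surjectivity of the stacked
  matrix, and independence of the family for \<^emph>\<open>every\<close> choice of unit vectors \<open>wbar j\<close>; that some
  \<open>wbar\<close> arises as a limit along a subsequence is compactness of the unit spheres.

  Conversely, weak-nondegeneracy alone controls only those \<open>wbar\<close> that arise from sequences.
  Surjectivity makes every choice of unit vectors \<open>c j\<close> arise: there is one direction \<open>d\<close> in which
  the derivative of each \<open>hat \<circ> g j\<close>, \<open>j\<close> in \<open>I0\<close>, is \<open>c j\<close>, and along \<open>x + d / (k + 1)\<close> the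
  normalized hat parts tend to \<open>c j\<close>
  (\<open>weak_nondegenerate_independent_for_direction\<close>). Given a vanishing combination as in the
  definition of nondegeneracy, choose \<open>c j\<close> to be the direction of the coefficient vector of the
  hat rows of block \<open>j\<close>. The combination is then one of the family for \<open>c\<close>, so it is trivial.
\<close>

section \<open>Linear independence of finite families\<close>

lemma lin_indep_familyI:
  fixes F :: "'i \<Rightarrow> 'a::real_vector"
  assumes fin: "finite S"
    and triv: "\<And>c s. (\<Sum>s\<in>S. c s *\<^sub>R F s) = 0 \<Longrightarrow> s \<in> S \<Longrightarrow> c s = 0"
  shows "lin_indep_family F S"
proof -
  have inj: "inj_on F S"
  proof (rule inj_onI, rule ccontr)
    fix s t assume st: "s \<in> S" "t \<in> S" "F s = F t" "s \<noteq> t"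
    define c :: "'i \<Rightarrow> real" where "c = (\<lambda>r. of_bool (r = s) - of_bool (r = t))"
    have "(\<Sum>r\<in>S. c r *\<^sub>R F r)
        = (\<Sum>r\<in>S. if r = s then F r else 0) - (\<Sum>r\<in>S. if r = t then F r else 0)"
      unfolding sum_subtractf[symmetric] by (rule sum.cong) (auto simp: c_def)
    also have "\<dots> = 0" using st fin by simp
    finally have "c s = 0" using triv st(1) by blast
    with st(4) show False by (simp add: c_def)
  qed
  have "\<not> dependent (F ` S)"
  proof
    assume "dependent (F ` S)"
    then obtain u where u: "\<exists>v\<in>F ` S. u v \<noteq> 0" "(\<Sum>v\<in>F ` S. u v *\<^sub>R v) = 0"
      using fin by (auto simp: dependent_finite)
    have "(\<Sum>s\<in>S. u (F s) *\<^sub>R F s) = 0"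
      using u(2) inj by (simp add: sum.reindex)
    with triv[of "\<lambda>s. u (F s)"] u(1) show False by blast
  qed
  with inj show ?thesis by (simp add: lin_indep_family_def)
qed

lemma lin_indep_familyD:
  fixes F :: "'i \<Rightarrow> 'a::real_vector"
  assumes ind: "lin_indep_family F S" and fin: "finite S"
    and zero: "(\<Sum>s\<in>S. c s *\<^sub>R F s) = 0" and s: "s \<in> S"
  shows "c s = 0"
proof -
  have inj: "inj_on F S" and ind': "independent (F ` S)"
    using ind by (auto simp: lin_indep_family_def)
  define u where "u v = c (the_inv_into S F v)" for v
  have u: "u (F s) = c s" if "s \<in> S" for s
    using that inj by (simp add: u_def the_inv_into_f_f)
  have "(\<Sum>v\<in>F ` S. u v *\<^sub>R v) = (\<Sum>s\<in>S. c s *\<^sub>R F s)"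
    using inj by (simp add: sum.reindex u)
  with zero have "u (F s) = 0"
    using independentD[OF ind', of "F ` S" u "F s"] fin s by simp
  with u s show ?thesis by simp
qed

text \<open>Values on independent vectors extend to a linear functional, and a functional on a Euclidean
  space is the inner product with a vector. For the rows of a matrix this says that independent
  rows make the matrix surjective.\<close>

lemma lin_indep_family_inner_values:
  fixes F :: "'i \<Rightarrow> 'a::euclidean_space" and c :: "'i \<Rightarrow> real"
  assumes "lin_indep_family F S"
  obtains d where "\<And>s. s \<in> S \<Longrightarrow> F s \<bullet> d = c s"
proof -
  have inj: "inj_on F S" and ind: "independent (F ` S)"
    using assms by (auto simp: lin_indep_family_def)
  obtain h where h: "linear h" "\<forall>v\<in>F ` S. h v = c (the_inv_into S F v)"
    using linear_independent_extend[OF ind, of "\<lambda>v. c (the_inv_into S F v)"] by auto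
  have "F s \<bullet> adjoint h 1 = c s" if "s \<in> S" for s
  proof -
    have "h (F s) = c s" using that h(2) inj by (simp add: the_inv_into_f_f)
    then show ?thesis using adjoint_works[OF h(1), of "F s" 1] by simp
  qed
  then show ?thesis using that by blast
qed

section \<open>Blocks split into leading and hat components\<close>

lemma Rsp_iff: "y \<in> Rsp k \<longleftrightarrow> (\<forall>i\<ge>k. y i = 0)"
  by (simp add: topspace_Euclidean_space)

lemma transp_app_case_nat:
  assumes "1 \<le> k"
  shows "transp_app k J (case_nat a u) = a *\<^sub>R J 0 + (\<Sum>i<k - 1. u i *\<^sub>R J (Suc i))"
proof -
  obtain l where "k = Suc l" using assms by (cases k) auto
  then show ?thesis by (simp add: transp_app_def sum.lessThan_Suc_shift del: sum.lessThan_Suc)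
qed

lemma case_nat_hat: "case_nat (y 0) (hat y) = y"
  by (rule ext) (simp add: hat_def split: nat.split)

lemma enorm_eq_0_iff: "enorm k y = 0 \<longleftrightarrow> (\<forall>i<k. y i = 0)"
  by (auto simp: enorm_def L2_set_eq_0_iff)

lemma limitin_Euclidean_space_iff:
  "limitin (Euclidean_space k) h l F \<longleftrightarrow>
     l \<in> Rsp k \<and> (\<forall>\<^sub>F n in F. h n \<in> Rsp k) \<and> (\<forall>i. ((\<lambda>n. h n i) \<longlongrightarrow> l i) F)"
proof -
  have "limitin (Euclidean_space k) h l F \<longleftrightarrow>
      l \<in> {x. \<forall>i\<ge>k. x i = 0} \<and> (\<forall>\<^sub>F n in F. h n \<in> {x. \<forall>i\<ge>k. x i = 0}) \<and>
      limitin (powertop_real UNIV) h l F"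
    unfolding Euclidean_space_def by (rule limitin_subtopology)
  also have "limitin (powertop_real UNIV) h l F \<longleftrightarrow> (\<forall>i. ((\<lambda>n. h n i) \<longlongrightarrow> l i) F)"
    unfolding limitin_componentwise by simp
  finally show ?thesis unfolding topspace_Euclidean_space .
qed

text \<open>The openness shows that a boundary point of the cone satisfies \<open>y 0 = \<parallel>hat y\<parallel>\<close>.\<close>

lemma openin_soc_interior:
  "openin (Euclidean_space k) {y \<in> Rsp k. enorm (k - 1) (hat y) < y 0}"
proof -
  have E: "Euclidean_space k = top_of_set {y. \<forall>i\<ge>k. y i = 0}"
    by (simp add: Euclidean_space_def euclidean_product_topology)
  have "open {y::nat \<Rightarrow> real. enorm (k - 1) (hat y) < y 0}"
    unfolding enorm_def hat_def L2_set_def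
    by (intro open_Collect_less continuous_intros continuous_on_product_coordinates)
  then show ?thesis unfolding topspace_Euclidean_space E
    by (auto simp: openin_open Int_def)
qed

text \<open>On the boundary \<open>y 0 = \<parallel>hat y\<parallel>\<close>, and this is positive since \<open>y\<close> is not the origin; hence
  \<open>\<Gamma> y = (y 0, - hat y) = y 0 (1, - w)\<close> with \<open>w\<close> the direction of \<open>hat y\<close>. So the boundary terms of
  the two qualifications differ only by positive factors.\<close>

lemma bd_plus_eigen_decomposition:
  assumes "y \<in> soc k" "y \<in> bd_plus k" "1 \<le> k"
  shows "0 < y 0" and "\<And>i. i < k \<Longrightarrow> Gamma_app k y i = 2 * y 0 * eig1 (hat_dir k y) i"
proof -
  have R: "y \<in> Rsp k" and ge: "enorm (k - 1) (hat y) \<le> y 0" and nz: "y \<noteq> zvec"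
    and ni: "y \<notin> Euclidean_space k interior_of soc k"
    using assms by (auto simp: soc_def bd_plus_def frontier_of_def)
  have "{y \<in> Rsp k. enorm (k - 1) (hat y) < y 0} \<subseteq> Euclidean_space k interior_of soc k"
    by (rule interior_of_maximal[OF _ openin_soc_interior]) (auto simp: soc_def)
  with R ge ni have eq: "y 0 = enorm (k - 1) (hat y)" by fastforce
  show pos: "0 < y 0"
  proof (rule ccontr)
    assume "\<not> 0 < y 0"
    moreover have "0 \<le> y 0" unfolding eq by (simp add: enorm_def)
    ultimately have y0: "y 0 = 0" by simp
    then have "enorm (k - 1) (hat y) = 0" using eq by simp
    then have h: "hat y i = 0" if "i < k - 1" for i using that by (simp add: enorm_eq_0_iff)
    have "y i = 0" for i
    proof (cases i)
      case (Suc l)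
      then show ?thesis using h[of l] R by (cases "i < k") (auto simp: hat_def Rsp_iff)
    qed (simp add: y0)
    with nz show False by auto
  qed
  fix i assume i: "i < k"
  have "Gamma_app k y i = (if i = 0 then 1 else - 1) * y i"
  proof -
    have "Gamma_app k y i = (\<Sum>l<k. if l = i then (if i = 0 then 1 else - 1) * y i else 0)"
      unfolding Gamma_app_def Gamma_mat_def by (rule sum.cong) auto
    then show ?thesis using i by simp
  qed
  then show "Gamma_app k y i = 2 * y 0 * eig1 (hat_dir k y) i"
    using pos eq by (auto simp: eig1_def hat_dir_def hat_def split: nat.split)
qed

lemma transp_app_Gamma_bd_plus:
  assumes "y \<in> soc k" "y \<in> bd_plus k" "1 \<le> k"
  shows "transp_app k J (Gamma_app k y) = (2 * y 0) *\<^sub>R transp_app k J (eig1 (hat_dir k y))"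
  using bd_plus_eigen_decomposition(2)[OF assms]
  by (simp add: transp_app_def scaleR_sum_right)

section \<open>Unit directions\<close>

lemma dirs_unit:
  assumes "w \<in> dirs k y" "y \<in> Rsp k"
  shows "w \<in> Rsp (k - 1)" "enorm (k - 1) w = 1"
proof -
  show "w \<in> Rsp (k - 1)" using assms by (simp add: dirs_def)
  show "enorm (k - 1) w = 1"
  proof (cases "hat y = zvec")
    case True then show ?thesis using assms by (simp add: dirs_def)
  next
    case False
    then have w: "w = hat_dir k y" using assms by (simp add: dirs_def)
    have nz: "enorm (k - 1) (hat y) \<noteq> 0"
    proof
      assume "enorm (k - 1) (hat y) = 0"
      then have "hat y i = 0" for i
        using assms(2) by (cases "i < k - 1") (auto simp: enorm_eq_0_iff Rsp_iff hat_def)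
      with False show False by auto
    qed
    have "enorm (k - 1) w = enorm (k - 1) (\<lambda>i. (1 / enorm (k - 1) (hat y)) * hat y i)"
      unfolding w hat_dir_def by simp
    also have "\<dots> = (1 / enorm (k - 1) (hat y)) * enorm (k - 1) (hat y)"
      unfolding enorm_def by (rule L2_set_right_distrib[symmetric]) simp
    also have "\<dots> = 1" using nz by simp
    finally show ?thesis .
  qed
qed

lemma enorm_axis: "0 < l \<Longrightarrow> enorm l (\<lambda>i. if i = 0 then 1 else 0) = 1"
  by (simp add: enorm_def L2_set_def if_distrib[of "\<lambda>x. x ^ 2"] cong: if_cong)

lemma dirs_nonempty:
  assumes "2 \<le> k" "y \<in> Rsp k"
  shows "dirs k y \<noteq> {}"
proof (cases "hat y = zvec")
  case True
  then have "(\<lambda>i. if i = 0 then 1 else 0) \<in> dirs k y"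
    using assms by (auto simp: dirs_def Rsp_iff enorm_axis)
  then show ?thesis by blast
next
  case False
  then have "hat_dir k y \<in> dirs k y"
    using assms by (auto simp: dirs_def Rsp_iff hat_dir_def hat_def)
  then show ?thesis by blast
qed

text \<open>At \<open>u = 0\<close> any unit vector serves, which is why \<open>u\<close> is expressed by \<open>c\<close> and not conversely.\<close>

lemma unit_direction_scaling:
  assumes "u \<in> Rsp l" "0 < l"
  obtains c where "c \<in> Rsp l" "enorm l c = 1" "\<And>i. u i = enorm l u * c i"
proof (cases "enorm l u = 0")
  case True
  then have "u i = 0" for i using assms(1) by (cases "i < l") (auto simp: enorm_eq_0_iff Rsp_iff)
  then show ?thesis
    using that[of "\<lambda>i. if i = 0 then 1 else 0"] True assms by (auto simp: enorm_axis Rsp_iff)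
next
  case False
  have "enorm l (\<lambda>i. (1 / enorm l u) * u i) = (1 / enorm l u) * enorm l u"
    unfolding enorm_def by (rule L2_set_right_distrib[symmetric]) simp
  with False show ?thesis
    using that[of "\<lambda>i. (1 / enorm l u) * u i"] assms by (auto simp: Rsp_iff)
qed

lemma abs_le_enorm: "i < k \<Longrightarrow> \<bar>y i\<bar> \<le> enorm k y"
  unfolding enorm_def L2_set_def
  by (rule real_le_rsqrt) (simp add: member_le_sum[of i "{..<k}" "\<lambda>i. (y i)\<^sup>2"])

lemma tendsto_enorm:
  assumes "\<And>i. i < k \<Longrightarrow> ((\<lambda>n. h n i) \<longlongrightarrow> l i) F"
  shows "((\<lambda>n. enorm k (h n)) \<longlongrightarrow> enorm k l) F"
  unfolding enorm_def L2_set_def by (intro tendsto_intros) (use assms in auto)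

section \<open>Convergent subsequences\<close>

text \<open>The product of the intervals \<open>[-1, 1]\<close> over all pairs of indices is compact by Tychonoff and
  first countable, hence sequentially compact. One subsequence thus serves all blocks and all
  components at once.\<close>

lemma bounded_componentwise_subsequence:
  fixes h :: "nat \<Rightarrow> nat \<Rightarrow> nat \<Rightarrow> real"
  assumes "\<And>k j i. \<bar>h k j i\<bar> \<le> 1"
  obtains r :: "nat \<Rightarrow> nat" and l :: "nat \<Rightarrow> nat \<Rightarrow> real"
  where "strict_mono r" "\<And>j i. (\<lambda>k. h (r k) j i) \<longlonglongrightarrow> l j i"
proof -
  define C :: "(nat \<Rightarrow> real) set" where "C = PiE UNIV (\<lambda>_. {-1..1})"
  have "compactin (powertop_real UNIV) C"
    unfolding C_def by (subst compactin_PiE) simp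
  then have C: "compact C" by (simp add: euclidean_product_topology)
  then have "compactin (product_topology (\<lambda>_. euclidean) UNIV) (PiE (UNIV::nat set) (\<lambda>_. C))"
    by (subst compactin_PiE) simp
  then have "compact (PiE (UNIV::nat set) (\<lambda>_. C))" by (simp add: euclidean_product_topology)
  then have "seq_compact (PiE (UNIV::nat set) (\<lambda>_. C))" by (rule compact_imp_seq_compact)
  moreover have "h k \<in> PiE (UNIV::nat set) (\<lambda>_. C)" for k
    using assms[of k] by (auto simp: C_def abs_le_iff minus_le_iff)
  ultimately obtain l r where r: "strict_mono r" and l: "(h \<circ> r) \<longlonglongrightarrow> l"
    using seq_compactE[of "PiE (UNIV::nat set) (\<lambda>_. C)" h] by blast
  have "(\<lambda>k. h (r k) j) \<longlonglongrightarrow> l j" for j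
  proof -
    have "limitin (product_topology (\<lambda>_. euclidean) UNIV) (h \<circ> r) l sequentially"
      using l by (simp add: euclidean_product_topology)
    then show ?thesis by (simp add: limitin_componentwise o_def)
  qed
  then have "limitin (powertop_real UNIV) (\<lambda>k. h (r k) j) (l j) sequentially" for j
    by (simp add: euclidean_product_topology)
  then have "(\<lambda>k. h (r k) j i) \<longlonglongrightarrow> l j i" for i j by (simp add: limitin_componentwise)
  with r that show ?thesis by blast
qed

lemma eventually_along_range:
  assumes r: "strict_mono (r :: nat \<Rightarrow> nat)" and ev: "\<forall>\<^sub>F k in sequentially. P (r k)"
  shows "eventually P (inf sequentially (principal (range r)))"
proof -
  obtain N where N: "\<And>k. N \<le> k \<Longrightarrow> P (r k)"
    using ev by (auto simp: eventually_sequentially)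
  have "P n" if "r N \<le> n" "n \<in> range r" for n
    using that N strict_mono_less_eq[OF r] by auto
  then show ?thesis
    unfolding eventually_inf_principal eventually_sequentially by blast
qed

lemma tendsto_along_range:
  assumes "strict_mono (r :: nat \<Rightarrow> nat)" "(\<lambda>k. h (r k)) \<longlonglongrightarrow> (l :: 'a::topological_space)"
  shows "(h \<longlongrightarrow> l) (inf sequentially (principal (range r)))"
  using assms by (auto simp: tendsto_def intro!: eventually_along_range[OF assms(1)])

lemma along_infinite_neq_bot:
  "infinite (I :: nat set) \<Longrightarrow> inf sequentially (principal I) \<noteq> bot"
  unfolding trivial_limit_def eventually_inf_principal eventually_sequentially
  by (metis infinite_nat_iff_unbounded_le)

section \<open>Limits of normalized directions\<close>

lemma has_derivative_inner_grad:
  fixes h :: "real ^ 'n \<Rightarrow> real"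
  assumes "h differentiable (at x)"
  shows "(h has_derivative (\<lambda>d. grad h x \<bullet> d)) (at x)"
proof -
  have D: "(h has_derivative frechet_derivative h (at x)) (at x)"
    using assms by (simp add: frechet_derivative_works)
  then have lin: "linear (frechet_derivative h (at x))"
    by (rule has_derivative_linear)
  have "frechet_derivative h (at x) d = grad h x \<bullet> d" for d
  proof -
    have "frechet_derivative h (at x) d
        = frechet_derivative h (at x) (\<Sum>l\<in>UNIV. d $ l *\<^sub>R axis l 1)"
      by (simp add: basis_expansion scalar_mult_eq_scaleR[symmetric])
    also have "\<dots> = (\<Sum>l\<in>UNIV. d $ l * frechet_derivative h (at x) (axis l 1))"
      using lin by (simp add: linear_sum linear_scale)
    also have "\<dots> = grad h x \<bullet> d"
      by (simp add: grad_def inner_vec_def mult.commute)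
    finally show ?thesis .
  qed
  then have "frechet_derivative h (at x) = (\<lambda>d. grad h x \<bullet> d)" by (rule ext)
  with D show ?thesis by simp
qed

text \<open>Normalization ignores the positive factor \<open>Suc k\<close>, so this limit of rescaled values determines
  the limit of the directions.\<close>

lemma difference_quotient_tendsto:
  fixes h :: "real ^ 'n \<Rightarrow> real"
  assumes "h differentiable (at x)" "h x = 0"
  shows "(\<lambda>k. real (Suc k) * h (x + inverse (real (Suc k)) *\<^sub>R d)) \<longlonglongrightarrow> grad h x \<bullet> d"
proof -
  have "((\<lambda>t. h (x + t *\<^sub>R d)) has_derivative (\<lambda>t. grad h x \<bullet> (t *\<^sub>R d))) (at 0)"
    by (rule has_derivative_compose[of "\<lambda>t. x + t *\<^sub>R d" "\<lambda>t. t *\<^sub>R d" 0 UNIV h, simplified])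
      (auto intro!: derivative_eq_intros has_derivative_inner_grad assms)
  then have "((\<lambda>t. h (x + t *\<^sub>R d)) has_real_derivative grad h x \<bullet> d) (at 0)"
    by (simp add: has_field_derivative_def mult.commute[of _ "grad h x \<bullet> d"])
  then have "((\<lambda>t. (h (x + t *\<^sub>R d) - h x) / t) \<longlongrightarrow> grad h x \<bullet> d) (at 0)"
    by (simp add: has_field_derivative_iff)
  moreover have "filterlim (\<lambda>k. inverse (real (Suc k))) (at 0) sequentially"
    by (rule filterlim_atI[OF LIMSEQ_inverse_real_of_nat]) simp
  ultimately have "(\<lambda>k. (h (x + inverse (real (Suc k)) *\<^sub>R d) - h x) / inverse (real (Suc k)))
      \<longlonglongrightarrow> grad h x \<bullet> d"
    by (rule filterlim_compose)
  then show ?thesis using assms(2) by (simp add: divide_inverse mult.commute del: of_nat_Suc)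
qed

lemma hat_dir_scale:
  "0 < s \<Longrightarrow> hat_dir k (\<lambda>i. s * y i) = hat_dir k y"
proof -
  assume s: "0 < s"
  have "enorm (k - 1) (\<lambda>i. s * hat y i) = s * enorm (k - 1) (hat y)"
    unfolding enorm_def using s by (simp add: L2_set_right_distrib)
  moreover have "hat (\<lambda>i. s * y i) = (\<lambda>i. s * hat y i)" by (simp add: hat_def)
  ultimately show ?thesis using s by (simp add: hat_dir_def)
qed

text \<open>The limit has norm 1, so dividing by the norm is continuous there and the hat parts are
  eventually nonzero. Then the normalized hat part is the only admissible direction, and no free
  choice remains.\<close>

lemma hat_dir_tendsto:
  assumes lim: "\<And>i. i < k - 1 \<Longrightarrow> (\<lambda>n. s n * hat (Y n) i) \<longlonglongrightarrow> c i"
    and s: "\<And>n. 0 < s n" and R: "\<And>n. Y n \<in> Rsp k"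
    and c: "c \<in> Rsp (k - 1)" "enorm (k - 1) c = 1"
  shows "(\<lambda>n. hat_dir k (Y n) i) \<longlonglongrightarrow> c i" "\<forall>\<^sub>F n in sequentially. hat (Y n) \<noteq> zvec"
proof -
  have lim': "(\<lambda>n. s n * hat (Y n) i) \<longlonglongrightarrow> c i" for i
    using lim R c by (cases "i < k - 1") (auto simp: Rsp_iff hat_def)
  have N: "(\<lambda>n. enorm (k - 1) (\<lambda>i. s n * hat (Y n) i)) \<longlonglongrightarrow> 1"
    using tendsto_enorm[of "k - 1" "\<lambda>n i. s n * hat (Y n) i" c, OF lim] c by simp
  have "(\<lambda>n. s n * hat (Y n) i / enorm (k - 1) (\<lambda>i. s n * hat (Y n) i)) \<longlonglongrightarrow> c i / 1"
    by (intro tendsto_divide lim' N) simp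
  moreover have "s n * hat (Y n) i / enorm (k - 1) (\<lambda>i. s n * hat (Y n) i) = hat_dir k (Y n) i" for n
    using fun_cong[OF hat_dir_scale[of "s n" k "Y n", OF s], of i] by (simp add: hat_dir_def hat_def)
  ultimately show "(\<lambda>n. hat_dir k (Y n) i) \<longlonglongrightarrow> c i" by simp
  have "\<forall>\<^sub>F n in sequentially. 0 < enorm (k - 1) (\<lambda>i. s n * hat (Y n) i)"
    by (rule order_tendstoD[OF N]) simp
  then show "\<forall>\<^sub>F n in sequentially. hat (Y n) \<noteq> zvec"
  proof eventually_elim
    case (elim n) then show ?case by (auto simp: enorm_def L2_set_def)
  qed
qed

section \<open>The two constraint qualifications in coordinates\<close>

lemma finite_IB: "finite (IB q m g x)" and finite_I0: "finite (I0 q g x)"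
  by (simp_all add: IB_def I0_def)

text \<open>The arbitrary \<open>v j\<close> of nondegeneracy are split into a leading coefficient \<open>s j\<close> and
  coefficients \<open>u j\<close> of the hat rows, and the boundary terms are rescaled to eigenvectors. In this
  form the relation is directly comparable with \<open>sum_wnd_family\<close> below.\<close>

lemma nondegenerate_iff:
  assumes dim: "\<forall>j\<in>{1..q}. 2 \<le> m j" and feas: "feasible q m g x"
  shows "nondegenerate q m g x \<longleftrightarrow>
    (\<forall>(a :: nat \<Rightarrow> real) (s :: nat \<Rightarrow> real) (u :: nat \<Rightarrow> nat \<Rightarrow> real).
       (\<Sum>j\<in>IB q m g x. a j *\<^sub>R transp_app (m j) (jac (g j) x) (eig1 (hat_dir (m j) (g j x))))
       + (\<Sum>j\<in>I0 q g x. s j *\<^sub>R jac (g j) x 0 + (\<Sum>i<m j - 1. u j i *\<^sub>R jac (g j) x (Suc i))) = 0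
       \<longrightarrow> (\<forall>j\<in>IB q m g x. a j = 0) \<and> (\<forall>j\<in>I0 q g x. s j = 0 \<and> (\<forall>i<m j - 1. u j i = 0)))"
    (is "_ \<longleftrightarrow> ?R")
proof
  have IB: "g j x \<in> soc (m j)" "g j x \<in> bd_plus (m j)" "1 \<le> m j" if "j \<in> IB q m g x" for j
    using that feas bspec[OF dim, of j] by (auto simp: IB_def feasible_def)
  have bd: "transp_app (m j) (jac (g j) x) (Gamma_app (m j) (g j x))
      = (2 * g j x 0) *\<^sub>R transp_app (m j) (jac (g j) x) (eig1 (hat_dir (m j) (g j x)))"
    and pos: "0 < g j x 0" if "j \<in> IB q m g x" for j
    using transp_app_Gamma_bd_plus[OF IB[OF that]] bd_plus_eigen_decomposition(1)[OF IB[OF that]]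
    by blast+
  have dim0: "1 \<le> m j" if "j \<in> I0 q g x" for j
    using that bspec[OF dim, of j] by (auto simp: I0_def)
  {
    assume N: "nondegenerate q m g x"
    show ?R
    proof (intro allI impI)
      fix a s :: "nat \<Rightarrow> real" and u :: "nat \<Rightarrow> nat \<Rightarrow> real"
      assume zero: "(\<Sum>j\<in>IB q m g x. a j *\<^sub>R transp_app (m j) (jac (g j) x) (eig1 (hat_dir (m j) (g j x))))
        + (\<Sum>j\<in>I0 q g x. s j *\<^sub>R jac (g j) x 0 + (\<Sum>i<m j - 1. u j i *\<^sub>R jac (g j) x (Suc i))) = 0"
      (* u j is arbitrary beyond its first m j - 1 entries and has to be truncated
         for v j to lie in the block space. *)
      define v where "v j = case_nat (s j) (\<lambda>i. if i < m j - 1 then u j i else 0)" for j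
      have v: "v j \<in> Rsp (m j)" if "j \<in> I0 q g x" for j
        using dim0[OF that] by (auto simp: v_def Rsp_iff split: nat.split)
      have "(\<Sum>j\<in>IB q m g x. (a j / (2 * g j x 0)) *\<^sub>R transp_app (m j) (jac (g j) x) (Gamma_app (m j) (g j x)))
          + (\<Sum>j\<in>I0 q g x. transp_app (m j) (jac (g j) x) (v j)) = 0"
      proof -
        have "(a j / (2 * g j x 0)) *\<^sub>R transp_app (m j) (jac (g j) x) (Gamma_app (m j) (g j x))
            = a j *\<^sub>R transp_app (m j) (jac (g j) x) (eig1 (hat_dir (m j) (g j x)))"
          if "j \<in> IB q m g x" for j
          using pos[OF that] by (simp add: bd[OF that])
        moreover have "transp_app (m j) (jac (g j) x) (v j)
            = s j *\<^sub>R jac (g j) x 0 + (\<Sum>i<m j - 1. u j i *\<^sub>R jac (g j) x (Suc i))"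
          if "j \<in> I0 q g x" for j
          unfolding v_def transp_app_case_nat[OF dim0[OF that]] by simp
        ultimately show ?thesis using zero by simp
      qed
      then have "(\<forall>j\<in>IB q m g x. a j / (2 * g j x 0) = 0) \<and> (\<forall>j\<in>I0 q g x. v j = zvec)"
        using v by (intro N[unfolded nondegenerate_def, rule_format]) auto
      then have a: "\<forall>j\<in>IB q m g x. a j / (2 * g j x 0) = 0" and v0: "\<forall>j\<in>I0 q g x. v j = zvec"
        by blast+
      have "s j = 0 \<and> (\<forall>i<m j - 1. u j i = 0)" if "j \<in> I0 q g x" for j
      proof -
        have "v j i = 0" for i using v0 that by simp
        from this[of 0] this[of "Suc i" for i] show ?thesis
          by (auto simp: v_def) (metis)
      qed
      with a pos show "(\<forall>j\<in>IB q m g x. a j = 0) \<and> (\<forall>j\<in>I0 q g x. s j = 0 \<and> (\<forall>i<m j - 1. u j i = 0))"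
        by fastforce
    qed
  next
    assume R: ?R
    show "nondegenerate q m g x"
      unfolding nondegenerate_def
    proof (intro allI impI)
      fix a :: "nat \<Rightarrow> real" and v :: "nat \<Rightarrow> nat \<Rightarrow> real"
      assume v: "\<forall>j\<in>I0 q g x. v j \<in> Rsp (m j)"
        and zero: "(\<Sum>j\<in>IB q m g x. a j *\<^sub>R transp_app (m j) (jac (g j) x) (Gamma_app (m j) (g j x)))
          + (\<Sum>j\<in>I0 q g x. transp_app (m j) (jac (g j) x) (v j)) = 0"
      have "transp_app (m j) (jac (g j) x) (v j)
          = v j 0 *\<^sub>R jac (g j) x 0 + (\<Sum>i<m j - 1. hat (v j) i *\<^sub>R jac (g j) x (Suc i))"
        if "j \<in> I0 q g x" for j
        using transp_app_case_nat[OF dim0[OF that], of "jac (g j) x" "v j 0" "hat (v j)"]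
        by (simp add: case_nat_hat)
      with zero have "(\<Sum>j\<in>IB q m g x. (a j * (2 * g j x 0)) *\<^sub>R
            transp_app (m j) (jac (g j) x) (eig1 (hat_dir (m j) (g j x))))
          + (\<Sum>j\<in>I0 q g x. v j 0 *\<^sub>R jac (g j) x 0 + (\<Sum>i<m j - 1. hat (v j) i *\<^sub>R jac (g j) x (Suc i))) = 0"
        by (simp add: bd)
      from R[rule_format, OF this]
      have a: "\<And>j. j \<in> IB q m g x \<Longrightarrow> a j * (2 * g j x 0) = 0"
        and v0: "\<And>j. j \<in> I0 q g x \<Longrightarrow> v j 0 = 0"
        and vS: "\<And>j i. j \<in> I0 q g x \<Longrightarrow> i < m j - 1 \<Longrightarrow> hat (v j) i = 0"
        by auto
      have "v j i = 0" if j: "j \<in> I0 q g x" for j i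
      proof (cases i)
        case (Suc l)
        then show ?thesis using vS[OF j, of l] v j by (cases "i < m j") (auto simp: hat_def Rsp_iff)
      qed (simp add: v0 j)
      moreover have "a j = 0" if "j \<in> IB q m g x" for j
        using a[OF that] pos[OF that] by simp
      ultimately show "(\<forall>j\<in>IB q m g x. a j = 0) \<and> (\<forall>j\<in>I0 q g x. v j = zvec)" by auto
    qed
  }
qed

text \<open>Two coefficients \<open>p, r\<close> of \<open>(1, -w)\<close> and \<open>(1, w)\<close> give \<open>(p + r, (r - p) w)\<close>: they amount to
  free coefficients of \<open>(1, 0)\<close> and \<open>(0, w)\<close>.\<close>

lemma sum_wnd_family:
  assumes dim: "\<forall>j\<in>{1..q}. 2 \<le> m j"
  shows "(\<Sum>t\<in>IB q m g x <+> (I0 q g x <+> I0 q g x). c t *\<^sub>R wnd_family m g x wbar t)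
    = (\<Sum>j\<in>IB q m g x. c (Inl j) *\<^sub>R transp_app (m j) (jac (g j) x) (eig1 (hat_dir (m j) (g j x))))
    + (\<Sum>j\<in>I0 q g x. (c (Inr (Inl j)) + c (Inr (Inr j))) *\<^sub>R jac (g j) x 0
        + (\<Sum>i<m j - 1. ((c (Inr (Inr j)) - c (Inr (Inl j))) * wbar j i) *\<^sub>R jac (g j) x (Suc i)))"
proof -
  have blk: "c (Inr (Inl j)) *\<^sub>R transp_app (m j) (jac (g j) x) (case_nat 1 (\<lambda>k. - wbar j k))
      + c (Inr (Inr j)) *\<^sub>R transp_app (m j) (jac (g j) x) (case_nat 1 (wbar j))
      = (c (Inr (Inl j)) + c (Inr (Inr j))) *\<^sub>R jac (g j) x 0
        + (\<Sum>i<m j - 1. ((c (Inr (Inr j)) - c (Inr (Inl j))) * wbar j i) *\<^sub>R jac (g j) x (Suc i))"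
    if "j \<in> I0 q g x" for j
  proof -
    have "1 \<le> m j" using that bspec[OF dim, of j] by (auto simp: I0_def)
    then show ?thesis
      by (simp add: transp_app_case_nat algebra_simps scaleR_sum_right sum.distrib sum_negf sum_subtractf)
  qed
  show ?thesis
    by (simp add: sum.Plus finite_IB finite_I0 wnd_family_def o_def blk sum.distrib[symmetric])
qed

section \<open>Surjectivity of the stacked Jacobian\<close>

lemma jac_hat: "jac (\<lambda>z. hat (G z)) x i = jac G x (Suc i)"
  by (simp add: jac_def hat_def)

text \<open>This is what makes the stacked map take its values in the product of the block spaces.\<close>

lemma jac_eq_0_outside:
  assumes "range G \<subseteq> Rsp k" "k \<le> i"
  shows "jac G x i = 0"
proof -
  have "G z i = 0" for z
  proof -
    have "G z \<in> Rsp k" using assms(1) by blast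
    then show ?thesis using assms(2) by (simp add: Rsp_iff)
  qed
  then have "(\<lambda>z. G z i) = (\<lambda>z. 0)" by simp
  then show ?thesis by (simp add: jac_def grad_def vec_eq_iff)
qed

lemma stacked_map_in_codomain:
  assumes "\<forall>j\<in>{1..q}. range (g j) \<subseteq> Rsp (m j)"
  shows "stacked_map q g x d \<in> stacked_codomain q m g x"
proof -
  have "mat_app (jac (\<lambda>z. hat (g j z)) x) d \<in> Rsp (m j - 1)" if "j \<in> I0 q g x" for j
  proof -
    have "range (g j) \<subseteq> Rsp (m j)" using that assms by (simp add: I0_def)
    from jac_eq_0_outside[OF this] show ?thesis
      by (simp add: Rsp_iff mat_app_def jac_hat)
  qed
  then show ?thesis by (simp add: stacked_map_def stacked_codomain_def PiE_iff)
qed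

lemma stacked_map_surj:
  assumes g: "\<forall>j\<in>{1..q}. range (g j) \<subseteq> Rsp (m j)"
    and ind: "\<And>u :: nat \<Rightarrow> nat \<Rightarrow> real.
      (\<Sum>j\<in>I0 q g x. \<Sum>i<m j - 1. u j i *\<^sub>R jac (g j) x (Suc i)) = 0 \<Longrightarrow>
      \<forall>j\<in>I0 q g x. \<forall>i<m j - 1. u j i = 0"
  shows "range (stacked_map q g x) = stacked_codomain q m g x"
proof
  show "range (stacked_map q g x) \<subseteq> stacked_codomain q m g x"
    using stacked_map_in_codomain[OF g] by blast
next
  define S where "S = Sigma (I0 q g x) (\<lambda>j. {..<m j - 1})"
  define F where "F = (\<lambda>(j, i). jac (g j) x (Suc i))"
  have F: "lin_indep_family F S"
  proof (rule lin_indep_familyI)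
    show "finite S" by (simp add: S_def finite_I0)
    fix c :: "nat \<times> nat \<Rightarrow> real" and t
    assume z: "(\<Sum>t\<in>S. c t *\<^sub>R F t) = 0" and t: "t \<in> S"
    have "(\<Sum>j\<in>I0 q g x. \<Sum>i<m j - 1. c (j, i) *\<^sub>R jac (g j) x (Suc i)) = (\<Sum>t\<in>S. c t *\<^sub>R F t)"
      unfolding S_def F_def by (subst sum.Sigma) (auto simp: finite_I0 split_def)
    with ind[of "\<lambda>j i. c (j, i)"] z t show "c t = 0" by (auto simp: S_def)
  qed
  show "stacked_codomain q m g x \<subseteq> range (stacked_map q g x)"
  proof
    fix y assume y: "y \<in> stacked_codomain q m g x"
    obtain d where d: "\<And>t. t \<in> S \<Longrightarrow> F t \<bullet> d = (case t of (j, i) \<Rightarrow> y j i)"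
      using lin_indep_family_inner_values[OF F, of "\<lambda>(j, i). y j i"] by blast
    have "stacked_map q g x d = y"
    proof (rule PiE_ext)
      show "stacked_map q g x d \<in> (\<Pi>\<^sub>E j\<in>I0 q g x. Rsp (m j - 1))"
        using stacked_map_in_codomain[OF g, of x d] by (simp add: stacked_codomain_def)
      show "y \<in> (\<Pi>\<^sub>E j\<in>I0 q g x. Rsp (m j - 1))" using y by (simp add: stacked_codomain_def)
      fix j assume j: "j \<in> I0 q g x"
      have "stacked_map q g x d \<in> stacked_codomain q m g x" by (rule stacked_map_in_codomain[OF g])
      then have R: "stacked_map q g x d j \<in> Rsp (m j - 1)" "y j \<in> Rsp (m j - 1)"
        using j y by (auto simp: stacked_codomain_def)
      show "stacked_map q g x d j = y j"
      proof
        fix i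
        show "stacked_map q g x d j i = y j i"
        proof (cases "i < m j - 1")
          case True
          then show ?thesis using d[of "(j, i)"] j
            by (simp add: S_def F_def stacked_map_def mat_app_def jac_hat)
        next
          case False
          then show ?thesis using R by (simp add: Rsp_iff)
        qed
      qed
    qed
    then show "y \<in> range (stacked_map q g x)" by blast
  qed
qed

section \<open>The equivalence\<close>

text \<open>Compactness yields limits \<open>wbar j\<close> of any choice of directions along a subsequence. Being of
  norm 1 they are nonzero, which is all that independence needs: a multiple \<open>t wbar j\<close> as the
  coefficient vector of independent rows vanishes only for \<open>t = 0\<close>.\<close>

lemma nondegenerate_imp_weak_nondegenerate:
  assumes dim: "\<forall>j\<in>{1..q}. 2 \<le> m j"
    and g: "\<forall>j\<in>{1..q}. range (g j) \<subseteq> Rsp (m j)"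
    and feas: "feasible q m g x" and N: "nondegenerate q m g x"
  shows "weak_nondegenerate q m g x"
  unfolding weak_nondegenerate_def
proof (intro allI impI)
  fix X assume "X \<longlonglongrightarrow> x"
  have dim0: "2 \<le> m j" if "j \<in> I0 q g x" for j using that bspec[OF dim, of j] by (auto simp: I0_def)
  have gX: "g j z \<in> Rsp (m j)" if "j \<in> I0 q g x" for j z using that bspec[OF g, of j] by (auto simp: I0_def)
  define w where "w j k = (if j \<in> I0 q g x then SOME w. w \<in> dirs (m j) (g j (X k)) else zvec)" for j k
  have w: "w j k \<in> dirs (m j) (g j (X k))" if "j \<in> I0 q g x" for j k
    using dirs_nonempty[OF dim0 gX, OF that that] that by (simp add: w_def some_in_eq)
  have wR: "w j k \<in> Rsp (m j - 1)" and w1: "enorm (m j - 1) (w j k) = 1" if "j \<in> I0 q g x" for j k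
    using dirs_unit[OF w gX, OF that that] by blast+
  have "\<bar>w j k i\<bar> \<le> 1" for j k i
  proof (cases "j \<in> I0 q g x \<and> i < m j - 1")
    case True
    then show ?thesis using abs_le_enorm[of i "m j - 1" "w j k"] w1 by simp
  next
    case False
    then have "w j k i = 0" using wR[of j k] by (auto simp: w_def Rsp_iff)
    then show ?thesis by simp
  qed
  then obtain r wbar where r: "strict_mono r" and lim: "\<And>j i. (\<lambda>k. w j (r k) i) \<longlonglongrightarrow> wbar j i"
    using bounded_componentwise_subsequence[of "\<lambda>k j i. w j k i"] by blast
  have wbR: "wbar j \<in> Rsp (m j - 1)" if "j \<in> I0 q g x" for j
    unfolding Rsp_iff
  proof (intro allI impI)
    fix i assume "m j - 1 \<le> i"
    then have "(\<lambda>k. w j (r k) i) = (\<lambda>k. 0)" using wR[OF that] by (simp add: Rsp_iff)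
    with lim[of j i] show "wbar j i = 0" by (simp add: LIMSEQ_const_iff)
  qed
  have wb1: "enorm (m j - 1) (wbar j) = 1" if "j \<in> I0 q g x" for j
    using tendsto_enorm[of "m j - 1" "\<lambda>k. w j (r k)" "wbar j", OF lim] w1[OF that]
    by (simp add: LIMSEQ_const_iff)
  have E: "limitin (Euclidean_space (m j)) (\<lambda>k. e (w j k)) (e (wbar j))
      (inf sequentially (principal (range r)))"
    if j: "j \<in> I0 q g x" and e: "e = eig1 \<or> e = eig2" for j e
    unfolding limitin_Euclidean_space_iff
  proof (intro conjI allI)
    have R: "e v \<in> Rsp (m j)" if "v \<in> Rsp (m j - 1)" for v
      using e that dim0[OF j] by (auto simp: Rsp_iff eig1_def eig2_def split: nat.split)
    show "e (wbar j) \<in> Rsp (m j)" by (rule R[OF wbR[OF j]])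
    show "\<forall>\<^sub>F k in inf sequentially (principal (range r)). e (w j k) \<in> Rsp (m j)"
      by (intro always_eventually allI R wR j)
    fix i
    show "((\<lambda>k. e (w j k) i) \<longlongrightarrow> e (wbar j) i) (inf sequentially (principal (range r)))"
    proof (rule tendsto_along_range[OF r])
      show "(\<lambda>k. e (w j (r k)) i) \<longlonglongrightarrow> e (wbar j) i"
        using e by (cases i) (auto simp: eig1_def eig2_def intro!: tendsto_intros lim)
    qed
  qed
  have ind: "lin_indep_family (wnd_family m g x wbar) (IB q m g x <+> (I0 q g x <+> I0 q g x))"
  proof (rule lin_indep_familyI)
    show "finite (IB q m g x <+> (I0 q g x <+> I0 q g x))" by (simp add: finite_IB finite_I0)
    fix c :: "nat + (nat + nat) \<Rightarrow> real" and t
    assume z: "(\<Sum>t\<in>IB q m g x <+> (I0 q g x <+> I0 q g x). c t *\<^sub>R wnd_family m g x wbar t) = 0"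
      and t: "t \<in> IB q m g x <+> (I0 q g x <+> I0 q g x)"
    note R = N[unfolded nondegenerate_iff[OF dim feas], rule_format,
        OF z[unfolded sum_wnd_family[OF dim]]]
    have a: "c (Inl j) = 0" if "j \<in> IB q m g x" for j using R that by blast
    have "c (Inr (Inl j)) = 0 \<and> c (Inr (Inr j)) = 0" if j: "j \<in> I0 q g x" for j
    proof -
      have s: "c (Inr (Inl j)) + c (Inr (Inr j)) = 0" using R j by blast
      have "(c (Inr (Inr j)) - c (Inr (Inl j))) * wbar j i = 0" if "i < m j - 1" for i
        using R j that by blast
      moreover obtain i where "i < m j - 1" "wbar j i \<noteq> 0"
        using wb1[OF j] enorm_eq_0_iff[of "m j - 1" "wbar j"] by auto
      ultimately have "c (Inr (Inr j)) - c (Inr (Inl j)) = 0" by (metis mult_eq_0_iff)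
      with s show ?thesis by simp
    qed
    with a t show "c t = 0" by auto
  qed
  show "\<exists>(I :: nat set) (w :: nat \<Rightarrow> nat \<Rightarrow> nat \<Rightarrow> real) (wbar :: nat \<Rightarrow> nat \<Rightarrow> real).
      infinite I \<and>
      (\<forall>j\<in>I0 q g x.
        (\<forall>k\<in>I. w j k \<in> dirs (m j) (g j (X k))) \<and>
        wbar j \<in> Rsp (m j - 1) \<and> enorm (m j - 1) (wbar j) = 1 \<and>
        limitin (Euclidean_space (m j)) (\<lambda>k. eig1 (w j k)) (eig1 (wbar j))
          (inf sequentially (principal I)) \<and>
        limitin (Euclidean_space (m j)) (\<lambda>k. eig2 (w j k)) (eig2 (wbar j))
          (inf sequentially (principal I))) \<and>
      lin_indep_family (wnd_family m g x wbar) (IB q m g x <+> (I0 q g x <+> I0 q g x))"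
    using w wbR wb1 E ind range_inj_infinite[OF strict_mono_imp_inj_on[OF r]]
    by (intro exI[of _ "range r"] exI[of _ w] exI[of _ wbar]) simp
qed

text \<open>Weak-nondegeneracy promises an independent family only for some limit directions of a given
  sequence. Approaching \<open>x\<close> along a ray on which each \<open>hat \<circ> g j\<close> has derivative \<open>c j\<close> forces these limits
  to be the prescribed \<open>c j\<close>; surjectivity supplies such a ray for all blocks simultaneously.\<close>

lemma weak_nondegenerate_independent_for_direction:
  assumes smooth: "\<forall>j\<in>{1..q}. cont_diff_map (m j) (g j)"
    and weak: "weak_nondegenerate q m g x"
    and surj: "range (stacked_map q g x) = stacked_codomain q m g x"
    and c: "\<And>j. j \<in> I0 q g x \<Longrightarrow> c j \<in> Rsp (m j - 1)"
           "\<And>j. j \<in> I0 q g x \<Longrightarrow> enorm (m j - 1) (c j) = 1"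
  shows "lin_indep_family (wnd_family m g x c) (IB q m g x <+> (I0 q g x <+> I0 q g x))"
proof -
  have "restrict c (I0 q g x) \<in> stacked_codomain q m g x" using c(1) by (simp add: stacked_codomain_def)
  then obtain d where d: "stacked_map q g x d = restrict c (I0 q g x)" using surj by (metis imageE)
  have Jd: "jac (g j) x (Suc i) \<bullet> d = c j i" if "j \<in> I0 q g x" for j i
    using fun_cong[OF fun_cong[OF d], of j i] that by (simp add: stacked_map_def mat_app_def jac_hat)
  define X where "X k = x + inverse (real (Suc k)) *\<^sub>R d" for k
  have "X \<longlonglongrightarrow> x + 0 *\<^sub>R d"
    unfolding X_def by (intro tendsto_intros LIMSEQ_inverse_real_of_nat)
  then have "X \<longlonglongrightarrow> x" by simp
  then obtain I w wbar where I: "infinite I"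
    and w: "\<And>j k. j \<in> I0 q g x \<Longrightarrow> k \<in> I \<Longrightarrow> w j k \<in> dirs (m j) (g j (X k))"
    and lim: "\<And>j. j \<in> I0 q g x \<Longrightarrow> limitin (Euclidean_space (m j)) (\<lambda>k. eig2 (w j k)) (eig2 (wbar j))
                (inf sequentially (principal I))"
    and ind: "lin_indep_family (wnd_family m g x wbar) (IB q m g x <+> (I0 q g x <+> I0 q g x))"
    using weak unfolding weak_nondegenerate_def by metis
  have wbar: "wbar j = c j" if j: "j \<in> I0 q g x" for j
  proof
    fix i
    have sm: "cont_diff_map (m j) (g j)" and gx: "g j x = zvec" using j smooth by (auto simp: I0_def)
    have R: "g j z \<in> Rsp (m j)" for z using sm by (auto simp: cont_diff_map_def)
    have quot: "(\<lambda>k. real (Suc k) * hat (g j (X k)) i) \<longlonglongrightarrow> c j i" if "i < m j - 1" for i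
    proof -
      have "(\<lambda>z. g j z (Suc i)) differentiable (at x)"
        using sm that by (auto simp: cont_diff_map_def cont_diff_def)
      from difference_quotient_tendsto[OF this, of d] show ?thesis
        using gx Jd[OF j, of i] by (simp add: hat_def X_def jac_def del: of_nat_Suc)
    qed
    have pos: "0 < real (Suc k)" for k by simp
    note H = hat_dir_tendsto[of "m j" "\<lambda>k. real (Suc k)" "\<lambda>k. g j (X k)" "c j", OF quot pos R c[OF j]]
    let ?F = "inf sequentially (principal I)"
    have le: "?F \<le> sequentially" by simp
    have "\<forall>\<^sub>F k in ?F. hat (g j (X k)) \<noteq> zvec" by (rule filter_leD[OF le H(2)])
    moreover have "\<forall>\<^sub>F k in ?F. k \<in> I" by (simp add: eventually_inf_principal)
    ultimately have ev: "\<forall>\<^sub>F k in ?F. hat_dir (m j) (g j (X k)) i = w j k i"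
    proof eventually_elim
      case (elim k)
      then show ?case using w[OF j, of k] by (simp add: dirs_def)
    qed
    have "((\<lambda>k. hat_dir (m j) (g j (X k)) i) \<longlongrightarrow> c j i) ?F"
      by (rule tendsto_mono[OF le H(1)])
    then have 1: "((\<lambda>k. w j k i) \<longlongrightarrow> c j i) ?F"
      using ev by (simp add: tendsto_cong)
    have "((\<lambda>k. eig2 (w j k) (Suc i)) \<longlongrightarrow> eig2 (wbar j) (Suc i)) ?F"
      using lim[OF j] unfolding limitin_Euclidean_space_iff by blast
    then have "((\<lambda>k. 2 * (1/2 * w j k i)) \<longlongrightarrow> 2 * (1/2 * wbar j i)) ?F"
      unfolding eig2_def nat.case by (rule tendsto_mult_left)
    then have 2: "((\<lambda>k. w j k i) \<longlongrightarrow> wbar j i) ?F" by simp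
    show "wbar j i = c j i"
      by (rule tendsto_unique[OF along_infinite_neq_bot[OF I] 2 1])
  qed
  have "wnd_family m g x wbar t = wnd_family m g x c t"
    if "t \<in> IB q m g x <+> (I0 q g x <+> I0 q g x)" for t
    using that wbar by (auto simp: wnd_family_def)
  then show ?thesis
    using ind by (simp add: lin_indep_family_def cong: inj_on_cong image_cong)
qed

text \<open>Taking \<open>c j\<close> to be the direction of the hat coefficients \<open>u j\<close> turns an arbitrary relation among
  the rows into one of the family that is independent for \<open>c\<close>.\<close>

lemma weak_nondegenerate_surj_imp_nondegenerate:
  assumes dim: "\<forall>j\<in>{1..q}. 2 \<le> m j"
    and smooth: "\<forall>j\<in>{1..q}. cont_diff_map (m j) (g j)"
    and feas: "feasible q m g x"
    and weak: "weak_nondegenerate q m g x"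
    and surj: "range (stacked_map q g x) = stacked_codomain q m g x"
  shows "nondegenerate q m g x"
  unfolding nondegenerate_iff[OF dim feas]
proof (intro allI impI)
  fix a s :: "nat \<Rightarrow> real" and u :: "nat \<Rightarrow> nat \<Rightarrow> real"
  assume zero: "(\<Sum>j\<in>IB q m g x. a j *\<^sub>R transp_app (m j) (jac (g j) x) (eig1 (hat_dir (m j) (g j x))))
    + (\<Sum>j\<in>I0 q g x. s j *\<^sub>R jac (g j) x 0 + (\<Sum>i<m j - 1. u j i *\<^sub>R jac (g j) x (Suc i))) = 0"
  define rho where "rho j = enorm (m j - 1) (u j)" for j
  have "\<exists>c. c \<in> Rsp (m j - 1) \<and> enorm (m j - 1) c = 1 \<and> (\<forall>i<m j - 1. u j i = rho j * c i)"
    if "j \<in> I0 q g x" for j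
  proof -
    let ?v = "\<lambda>i. if i < m j - 1 then u j i else 0"
    have e: "enorm (m j - 1) ?v = rho j" by (simp add: rho_def enorm_def L2_set_def)
    have l: "0 < m j - 1" using that bspec[OF dim, of j] by (auto simp: I0_def)
    have "?v \<in> Rsp (m j - 1)" by (simp add: Rsp_iff)
    then obtain c where c: "c \<in> Rsp (m j - 1)" "enorm (m j - 1) c = 1"
      and vc: "\<And>i. ?v i = enorm (m j - 1) ?v * c i"
      using unit_direction_scaling[OF _ l, of ?v] by blast
    have "u j i = rho j * c i" if "i < m j - 1" for i using vc[of i] that unfolding e by simp
    with c show ?thesis by blast
  qed
  then obtain c where c: "\<And>j. j \<in> I0 q g x \<Longrightarrow> c j \<in> Rsp (m j - 1)"
      "\<And>j. j \<in> I0 q g x \<Longrightarrow> enorm (m j - 1) (c j) = 1"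
    and uc: "\<And>j i. j \<in> I0 q g x \<Longrightarrow> i < m j - 1 \<Longrightarrow> u j i = rho j * c j i"
    by metis
  have ind: "lin_indep_family (wnd_family m g x c) (IB q m g x <+> (I0 q g x <+> I0 q g x))"
    by (rule weak_nondegenerate_independent_for_direction[OF smooth weak surj c])
  (* The coefficients p, r of (1, -c j) and (1, c j) solve p + r = s j and r - p = rho j. *)
  define b where "b = case_sum a (case_sum (\<lambda>j. (s j - rho j) / 2) (\<lambda>j. (s j + rho j) / 2))"
  have half: "(s j - rho j) / 2 + (s j + rho j) / 2 = s j" "(s j + rho j) / 2 - (s j - rho j) / 2 = rho j" for j
    by (simp_all add: field_simps)
  have b0: "(\<Sum>t\<in>IB q m g x <+> (I0 q g x <+> I0 q g x). b t *\<^sub>R wnd_family m g x c t) = 0"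
  proof -
    have "(\<Sum>i<m j - 1. (rho j * c j i) *\<^sub>R jac (g j) x (Suc i))
        = (\<Sum>i<m j - 1. u j i *\<^sub>R jac (g j) x (Suc i))" if "j \<in> I0 q g x" for j
      using uc[OF that] by (intro sum.cong) auto
    then show ?thesis
      unfolding sum_wnd_family[OF dim] using zero by (simp add: b_def half del: One_nat_def)
  qed
  have fin: "finite (IB q m g x <+> (I0 q g x <+> I0 q g x))" by (simp add: finite_IB finite_I0)
  have b: "b t = 0" if "t \<in> IB q m g x <+> (I0 q g x <+> I0 q g x)" for t
    by (rule lin_indep_familyD[OF ind fin b0 that])
  have "a j = 0" if "j \<in> IB q m g x" for j using b[OF InlI[OF that]] by (simp add: b_def)
  moreover have "s j = 0 \<and> rho j = 0" if "j \<in> I0 q g x" for j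
    using b[OF InrI[OF InlI[OF that]]] b[OF InrI[OF InrI[OF that]]] by (simp add: b_def)
  ultimately show "(\<forall>j\<in>IB q m g x. a j = 0) \<and> (\<forall>j\<in>I0 q g x. s j = 0 \<and> (\<forall>i<m j - 1. u j i = 0))"
    using uc by auto
qed

theorem proposition3p1:
  fixes f :: "real ^ 'n \<Rightarrow> real"
    and g :: "nat \<Rightarrow> real ^ 'n \<Rightarrow> nat \<Rightarrow> real"
    and m :: "nat \<Rightarrow> nat" and q :: nat and xbar :: "real ^ 'n"
  assumes "nsocp q m f g"
    and "feasible q m g xbar"
  shows "nondegenerate q m g xbar \<longleftrightarrow>
    weak_nondegenerate q m g xbar \<and>
    range (stacked_map q g xbar) = stacked_codomain q m g xbar"
proof -
  have dim: "\<forall>j\<in>{1..q}. 2 \<le> m j"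
    and smooth: "\<forall>j\<in>{1..q}. cont_diff_map (m j) (g j)"
    using assms(1) by (auto simp: nsocp_def)
  have g: "\<forall>j\<in>{1..q}. range (g j) \<subseteq> Rsp (m j)"
    using smooth by (simp add: cont_diff_map_def)
  have "range (stacked_map q g xbar) = stacked_codomain q m g xbar" if N: "nondegenerate q m g xbar"
  proof (rule stacked_map_surj[OF g])
    fix u :: "nat \<Rightarrow> nat \<Rightarrow> real"
    assume "(\<Sum>j\<in>I0 q g xbar. \<Sum>i<m j - 1. u j i *\<^sub>R jac (g j) xbar (Suc i)) = 0"
    then show "\<forall>j\<in>I0 q g xbar. \<forall>i<m j - 1. u j i = 0"
      using N[unfolded nondegenerate_iff[OF dim assms(2)], rule_format, of "\<lambda>_. 0" "\<lambda>_. 0" u]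
      by simp
  qed
  then show ?thesis
    using nondegenerate_imp_weak_nondegenerate[OF dim g assms(2)]
      weak_nondegenerate_surj_imp_nondegenerate[OF dim smooth assms(2)] by blast
qed

end
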